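(* $(F_{USCG}(\mathbb{R}^m),H_{\rm end})$ is the completion of $(F_{USCB}(\mathbb{R}^m),H_{\rm end})$; that is, $(F_{USCG}(\mathbb{R}^m),H_{\rm end})$ is a complete metric space containing $F_{USCB}(\mathbb{R}^m)$ as a dense subset.
   Context: A fuzzy set on $\mathbb{R}^m$ is a function $u:\mathbb{R}^m\to[0,1]$. For $\alpha\in(0,1]$, $[u]_\alpha=\{x:u(x)\ge\alpha\}$, and $[u]_0=\overline{\{x:u(x)>0\}}$. $F_{USCG}(\mathbb{R}^m)$ is the set of all upper semi-continuous fuzzy sets $u$ on $\mathbb{R}^m$ with $[u]_\alpha$ bounded for each $\alpha\in(0,1]$; $F_{USCB}(\mathbb{R}^m)$ is the set of all upper semi-continuous fuzzy sets $u$ on $\mathbb{R}^m$ with $[u]_0$ bounded (cuts may be empty). The endograph of $u$ is ${\rm end}\,u=\{(x,t)\in\mathbb{R}^m\times[0,1]:u(x)\ge t\}$, and the endograph metric is $H_{\rm end}(u,v)=H({\rm end}\,u,{\rm end}\,v)$, where $H(A,B)=\max\{\sup_{a\in A}\inf_{b\in B}d(a,b),\ \sup_{b\in B}\inf_{a\in A}d(a,b)\}$ is the Hausdorff metric on nonempty closed sets ($d$ Euclidean). *)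

theory Defs
  imports "HOL-Analysis.Analysis"
begin

definition fuzzy_set :: "(real ^ 'm \<Rightarrow> real) \<Rightarrow> bool" where
  "fuzzy_set u \<longleftrightarrow> (\<forall>x. u x \<in> {0..1})"

definition upper_semicontinuous :: "('a::topological_space \<Rightarrow> real) \<Rightarrow> bool" where
  "upper_semicontinuous u \<longleftrightarrow> (\<forall>x. \<forall>e>0. \<forall>\<^sub>F y in nhds x. u y < u x + e)"

definition cut :: "(real ^ 'm \<Rightarrow> real) \<Rightarrow> real \<Rightarrow> (real ^ 'm) set" where
  "cut u \<alpha> = (if \<alpha> = 0 then closure {x. u x > 0} else {x. u x \<ge> \<alpha>})"

definition F_USCG :: "(real ^ 'm \<Rightarrow> real) set" where
  "F_USCG = {u. fuzzy_set u \<and> upper_semicontinuous u \<and> (\<forall>\<alpha>\<in>{0<..1}. bounded (cut u \<alpha>))}"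

definition F_USCB :: "(real ^ 'm \<Rightarrow> real) set" where
  "F_USCB = {u. fuzzy_set u \<and> upper_semicontinuous u \<and> bounded (cut u 0)}"

definition endograph :: "(real ^ 'm \<Rightarrow> real) \<Rightarrow> ((real ^ 'm) \<times> real) set" where
  "endograph u = {(x, t). t \<in> {0..1} \<and> u x \<ge> t}"

text \<open>The suprema and infima are taken in \<^typ>\<open>ennreal\<close>, so that the formula is meaningful
  without boundedness assumptions. The metric on pairs is the Euclidean one, by the library's
  instance for products.\<close>

definition Hausdorff_dist :: "'a::metric_space set \<Rightarrow> 'a set \<Rightarrow> ennreal" where
  "Hausdorff_dist A B =
     max (SUP a\<in>A. INF b\<in>B. ennreal (dist a b)) (SUP b\<in>B. INF a\<in>A. ennreal (dist a b))"

definition H_end :: "(real ^ 'm \<Rightarrow> real) \<Rightarrow> (real ^ 'm \<Rightarrow> real) \<Rightarrow> real" where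
  "H_end u v = enn2real (Hausdorff_dist (endograph u) (endograph v))"

text \<open>The endograph of a fuzzy set contains all points \<open>(x, 0)\<close>; hence the extended distance is
  at most 1, and the conversion to \<^typ>\<open>real\<close> in \<^const>\<open>H_end\<close> loses nothing.\<close>

lemma Hausdorff_dist_endograph_le_1:
  assumes "fuzzy_set u" "fuzzy_set v"
  shows "Hausdorff_dist (endograph u) (endograph v) \<le> 1"
proof -
  have *: "(INF b\<in>endograph w. ennreal (dist a b)) \<le> 1"
    if w: "fuzzy_set w" and a: "a \<in> endograph z" for a and w z :: "real ^ 'a \<Rightarrow> real"
  proof -
    obtain x t where xt: "a = (x, t)" "t \<in> {0..1}"
      using a by (auto simp: endograph_def)
    have "(x, 0) \<in> endograph w"
      using w by (auto simp: endograph_def fuzzy_set_def)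
    then have "(INF b\<in>endograph w. ennreal (dist a b)) \<le> ennreal (dist a (x, 0))"
      by (rule INF_lower)
    also have "dist a (x, 0) = t"
      using xt by (simp add: dist_Pair_Pair dist_real_def)
    also have "ennreal t \<le> 1"
      using xt by (simp add: ennreal_le_1)
    finally show ?thesis .
  qed
  show ?thesis
    unfolding Hausdorff_dist_def
    using *[OF assms(2)] *[OF assms(1)]
    by (auto intro!: SUP_least simp: dist_commute)
qed

end

theory Submission
  imports Defs
begin

text \<open>The map \<open>u \<mapsto> endograph u\<close> turns fuzzy sets into subsets of \<open>\<real>\<^sup>m \<times> [0,1]\<close>, and it is
  injective, because \<open>u x\<close> is the largest height over \<open>x\<close>. Upper semicontinuity says exactly that
  this subset is closed (\<open>closed_endograph\<close>, \<open>usc_if_closed_endograph\<close>). The metric axioms are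
  therefore those of the Hausdorff distance on closed sets, which is at most 1 here since every
  endograph contains \<open>\<real>\<^sup>m \<times> {0}\<close>.

  For completeness, a Cauchy sequence of endographs has its topological upper limit
  \<open>E = (\<Inter>n. closure (\<Union>k\<ge>n. endograph (\<sigma> k)))\<close> as Hausdorff limit: points of \<open>E\<close> are close to late
  endographs by the Cauchy property, and points of late endographs are close to \<open>E\<close> because
  bounded sequences in \<open>\<real>\<^sup>m \<times> \<real>\<close> have cluster points. The properties that characterize
  endographs (\<open>endograph_of_closed\<close>) pass to \<open>E\<close>. The limit has bounded cuts because a point of
  its \<open>\<alpha>\<close>-cut is close to the \<open>\<alpha>/2\<close>-cut of a single late member of the sequence: the distance
  controls heights and positions at once.

  For density, all values below a level \<open>e\<close> are replaced by 0. The support then lies in the bounded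
  \<open>e\<close>-cut, and since the deleted part of the endograph has height less than \<open>e\<close>, it lies within \<open>e\<close>
  of the base \<open>\<real>\<^sup>m \<times> {0}\<close>.\<close>

section \<open>The endograph distance through approximating points\<close>

lemma Hausdorff_dist_commute: "Hausdorff_dist A B = Hausdorff_dist B A"
  unfolding Hausdorff_dist_def by (simp add: dist_commute max.commute)

lemma Hausdorff_dist_lessD:
  assumes "Hausdorff_dist A B < ennreal r" "a \<in> A"
  shows "\<exists>b\<in>B. dist a b < r"
proof -
  have "(INF b\<in>B. ennreal (dist a b)) \<le> (SUP a\<in>A. INF b\<in>B. ennreal (dist a b))"
    using assms(2) by (rule SUP_upper)
  also have "\<dots> < ennreal r"
    using assms(1) by (simp add: Hausdorff_dist_def)
  finally show ?thesis
    by (auto simp: INF_less_iff ennreal_less_iff)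
qed

lemma Hausdorff_dist_leI:
  assumes "\<And>a. a \<in> A \<Longrightarrow> \<exists>b\<in>B. dist a b \<le> r" "\<And>b. b \<in> B \<Longrightarrow> \<exists>a\<in>A. dist a b \<le> r"
  shows "Hausdorff_dist A B \<le> ennreal r"
proof -
  have "(INF b\<in>B. ennreal (dist a b)) \<le> ennreal r" if "a \<in> A" for a
    using assms(1)[OF that] by (meson INF_lower2 ennreal_leI)
  moreover have "(INF a\<in>A. ennreal (dist a b)) \<le> ennreal r" if "b \<in> B" for b
    using assms(2)[OF that] by (meson INF_lower2 ennreal_leI)
  ultimately show ?thesis
    unfolding Hausdorff_dist_def by (simp add: SUP_least)
qed

lemma H_end_commute: "H_end u v = H_end v u"
  unfolding H_end_def by (simp add: Hausdorff_dist_commute)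

text \<open>The hypotheses make the extended distance finite; an infinite one would be converted to the
  real number 0.\<close>

lemma H_end_lessD:
  assumes "fuzzy_set u" "fuzzy_set v" "H_end u v < r" "p \<in> endograph u"
  shows "\<exists>q\<in>endograph v. dist p q < r"
proof (rule Hausdorff_dist_lessD)
  let ?d = "Hausdorff_dist (endograph u) (endograph v)"
  have "?d < top"
    using Hausdorff_dist_endograph_le_1[OF assms(1,2)] ennreal_one_less_top
    by (rule order.strict_trans1)
  then have "?d = ennreal (H_end u v)"
    by (simp add: H_end_def)
  also have "\<dots> < ennreal r"
    using assms(3) by (simp add: ennreal_less_iff H_end_def)
  finally show "?d < ennreal r" .
qed (fact assms(4))

lemma H_end_leI:
  assumes "0 \<le> r"
    and "\<And>p. p \<in> endograph u \<Longrightarrow> \<exists>q\<in>endograph v. dist p q \<le> r"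
    and "\<And>q. q \<in> endograph v \<Longrightarrow> \<exists>p\<in>endograph u. dist p q \<le> r"
  shows "H_end u v \<le> r"
proof -
  have "Hausdorff_dist (endograph u) (endograph v) \<le> ennreal r"
    by (rule Hausdorff_dist_leI) (use assms(2,3) in auto)
  then show ?thesis
    unfolding H_end_def using assms(1) by (rule enn2real_leI[rotated])
qed

lemma H_end_triangle:
  assumes "fuzzy_set u" "fuzzy_set v" "fuzzy_set w"
  shows "H_end u w \<le> H_end u v + H_end v w"
proof (rule field_le_epsilon)
  fix e :: real
  assume "0 < e"
  define r where "r = H_end u v + e / 2"
  define s where "s = H_end v w + e / 2"
  have uv: "H_end u v < r" "H_end v u < r" and vw: "H_end v w < s" "H_end w v < s"
    using \<open>0 < e\<close> by (simp_all add: r_def s_def H_end_commute)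
  have "H_end u w \<le> r + s"
  proof (rule H_end_leI)
    show "0 \<le> r + s"
      using \<open>0 < e\<close> by (simp add: r_def s_def H_end_def)
  next
    fix p assume "p \<in> endograph u"
    then obtain q where "q \<in> endograph v" "dist p q < r"
      using H_end_lessD assms uv by blast
    moreover from this obtain z where "z \<in> endograph w" "dist q z < s"
      using H_end_lessD assms vw by blast
    ultimately show "\<exists>z\<in>endograph w. dist p z \<le> r + s"
      using dist_triangle[of p z q] by force
  next
    fix z assume "z \<in> endograph w"
    then obtain q where "q \<in> endograph v" "dist z q < s"
      using H_end_lessD assms vw by blast
    moreover from this obtain p where "p \<in> endograph u" "dist q p < r"
      using H_end_lessD assms uv by blast
    ultimately show "\<exists>p\<in>endograph u. dist p z \<le> r + s"
      using dist_triangle[of p z q] by (force simp: dist_commute)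
  qed
  then show "H_end u w \<le> H_end u v + H_end v w + e"
    by (simp add: r_def s_def)
qed

section \<open>Upper semicontinuity and closed endographs\<close>

lemma closed_endograph:
  assumes usc: "upper_semicontinuous u"
  shows "closed (endograph u)"
proof -
  have near: "\<forall>\<^sub>F q in nhds p. q \<notin> endograph u" if "p \<notin> endograph u" for p
  proof -
    obtain x t where p: "p = (x, t)"
      by fastforce
    consider "t \<notin> {0..1}" | "u x < t"
      using \<open>p \<notin> endograph u\<close> p by (auto simp: endograph_def not_le)
    then show ?thesis
    proof cases
      case 1
      have "open (UNIV \<times> (- {0..1::real}) :: ((real ^ 'a) \<times> real) set)"
        by (intro open_Times open_UNIV open_Compl closed_real_atLeastAtMost)
      then have "\<forall>\<^sub>F q in nhds p. q \<in> UNIV \<times> (- {0..1})"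
        using 1 p by (intro eventually_nhds_in_open) auto
      then show ?thesis
        by (rule eventually_mono) (auto simp: endograph_def)
    next
      case 2
      \<comment> \<open>Halfway between \<open>u x\<close> and \<open>t\<close>: nearby values of \<open>u\<close> stay below this level and nearby
        heights above it.\<close>
      define c where "c = (u x + t) / 2"
      have "\<forall>\<^sub>F y in nhds x. u y < u x + (t - u x) / 2"
        using usc 2 unfolding upper_semicontinuous_def by (meson diff_gt_0_iff_gt half_gt_zero)
      then have "\<forall>\<^sub>F y in nhds x. u y < c"
        by (rule eventually_mono) (simp add: c_def field_simps)
      moreover have "\<forall>\<^sub>F s in nhds t. c < s"
        using eventually_nhds_in_open[of "{c<..}" t] 2 by (auto simp: c_def)
      ultimately have "\<forall>\<^sub>F q in nhds p. u (fst q) < c \<and> c < snd q"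
        unfolding p nhds_prod by (auto simp: eventually_prod_filter)
      then show ?thesis
        by (rule eventually_mono) (auto simp: endograph_def)
    qed
  qed
  have "open (- endograph u)"
  proof (subst open_subopen, intro ballI)
    fix p assume "p \<in> - endograph u"
    then have "\<forall>\<^sub>F q in nhds p. q \<notin> endograph u"
      by (intro near) simp
    then obtain T where "open T" "p \<in> T" "\<forall>q\<in>T. q \<notin> endograph u"
      unfolding eventually_nhds by (elim exE conjE)
    then show "\<exists>T. open T \<and> p \<in> T \<and> T \<subseteq> - endograph u"
      by (intro exI[of _ T]) auto
  qed
  then show ?thesis
    by (simp add: closed_def)
qed

lemma usc_if_closed_endograph:
  assumes "fuzzy_set u" and cl: "closed (endograph u)"
  shows "upper_semicontinuous u"
  unfolding upper_semicontinuous_def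
proof (intro allI impI)
  fix x and e :: real
  assume "0 < e"
  have u01: "0 \<le> u y" "u y \<le> 1" for y
    using assms(1) by (auto simp: fuzzy_set_def)
  show "\<forall>\<^sub>F y in nhds x. u y < u x + e"
  proof (cases "u x + e \<le> 1")
    case True
    \<comment> \<open>The horizontal slice at height \<open>u x + e\<close> is closed and misses \<open>x\<close>.\<close>
    have "open ((\<lambda>y. (y, u x + e)) -` (- endograph u))"
      using cl by (intro open_vimage continuous_intros) (auto simp: open_Compl)
    then have "\<forall>\<^sub>F y in nhds x. y \<in> (\<lambda>y. (y, u x + e)) -` (- endograph u)"
      by (rule eventually_nhds_in_open) (use \<open>0 < e\<close> in \<open>auto simp: endograph_def\<close>)
    then show ?thesis
      by (rule eventually_mono)
        (use True \<open>0 < e\<close> u01(1)[of x] in \<open>auto simp: endograph_def\<close>)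
  next
    case False
    then show ?thesis
      by (intro always_eventually allI) (use u01(2) in \<open>force simp: not_le intro: le_less_trans\<close>)
  qed
qed

lemma endograph_mono_iff:
  assumes "fuzzy_set u"
  shows "endograph u \<subseteq> endograph v \<longleftrightarrow> (\<forall>x. u x \<le> v x)"
proof
  assume "endograph u \<subseteq> endograph v"
  moreover have "(x, u x) \<in> endograph u" for x
    using assms by (auto simp: endograph_def fuzzy_set_def)
  ultimately show "\<forall>x. u x \<le> v x"
    by (auto simp: endograph_def)
qed (force simp: endograph_def intro: order_trans)

lemma le_if_H_end_eq_0:
  assumes "fuzzy_set u" "fuzzy_set v" "upper_semicontinuous v" "H_end u v = 0"
  shows "u x \<le> v x"
proof -
  have "p \<in> closure (endograph v)" if "p \<in> endograph u" for p
    unfolding closure_approachable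
    using H_end_lessD[OF assms(1,2) _ that] assms(4) by (metis dist_commute)
  then have "endograph u \<subseteq> endograph v"
    using closed_endograph[OF assms(3)] by auto
  then show ?thesis
    using endograph_mono_iff[OF assms(1)] by blast
qed

lemma Metric_space_F_USCG: "Metric_space F_USCG H_end"
proof
  fix u v w :: "real ^ 'a \<Rightarrow> real"
  show "0 \<le> H_end u v"
    by (simp add: H_end_def)
  show "H_end u v = H_end v u"
    by (rule H_end_commute)
  show "H_end u v = 0 \<longleftrightarrow> u = v" if "u \<in> F_USCG" "v \<in> F_USCG"
  proof
    assume "H_end u v = 0"
    then show "u = v"
      using that le_if_H_end_eq_0[of u v] le_if_H_end_eq_0[of v u] H_end_commute[of u v]
      by (auto simp: F_USCG_def intro!: ext order_antisym)
  next
    assume "u = v"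
    moreover have "H_end v v \<le> 0"
      by (rule H_end_leI) auto
    ultimately show "H_end u v = 0"
      by (simp add: H_end_def order_antisym)
  qed
  show "H_end u w \<le> H_end u v + H_end v w"
    if "u \<in> F_USCG" "v \<in> F_USCG" "w \<in> F_USCG"
    using that H_end_triangle by (auto simp: F_USCG_def)
qed

text \<open>Closedness is needed for the supremum of the heights over a point to be attained.\<close>

lemma endograph_of_closed:
  fixes E :: "((real ^ 'm) \<times> real) set"
  assumes cl: "closed E"
    and height: "\<And>x t. (x, t) \<in> E \<Longrightarrow> t \<in> {0..1}"
    and base: "\<And>x. (x, 0) \<in> E"
    and down: "\<And>x s t. (x, t) \<in> E \<Longrightarrow> 0 \<le> s \<Longrightarrow> s \<le> t \<Longrightarrow> (x, s) \<in> E"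
  obtains u where "fuzzy_set u" "upper_semicontinuous u" "endograph u = E"
proof -
  define u where "u x = Sup {t. (x, t) \<in> E}" for x
  have bdd: "bdd_above {t. (x, t) \<in> E}" for x
    using height by (intro bdd_aboveI[of _ 1]) auto
  have top: "(x, u x) \<in> E" for x
  proof -
    have "closed ((\<lambda>t. (x, t)) -` E)"
      using cl by (intro continuous_closed_vimage continuous_intros) auto
    then have "closed {t. (x, t) \<in> E}"
      by (simp add: vimage_def)
    then have "u x \<in> {t. (x, t) \<in> E}"
      unfolding u_def using base bdd by (intro closed_contains_Sup) auto
    then show ?thesis
      by simp
  qed
  have "fuzzy_set u"
    unfolding fuzzy_set_def using top height by blast
  moreover have graph: "endograph u = E"
  proof (intro set_eqI iffI; clarify)
    fix x t
    assume "(x, t) \<in> endograph u"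
    then show "(x, t) \<in> E"
      using down[OF top] by (auto simp: endograph_def)
  next
    fix x t
    assume "(x, t) \<in> E"
    then show "(x, t) \<in> endograph u"
      using height[of x t] bdd unfolding endograph_def u_def by (auto intro: cSup_upper)
  qed
  ultimately show thesis
    using that usc_if_closed_endograph cl by blast
qed

section \<open>Completeness\<close>

definition upper_limit :: "(nat \<Rightarrow> 'a::topological_space set) \<Rightarrow> 'a set" where
  "upper_limit A = (\<Inter>n. closure (\<Union>k\<in>{n..}. A k))"

lemma upper_limit_approachable:
  fixes A :: "nat \<Rightarrow> 'a::metric_space set"
  shows "p \<in> upper_limit A \<longleftrightarrow> (\<forall>n. \<forall>e>0. \<exists>k\<ge>n. \<exists>q\<in>A k. dist q p < e)"
  unfolding upper_limit_def closure_approachable INT_iff by (simp add: Bex_def) blast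

text \<open>Both halves of the statement that a Cauchy sequence of sets converges to its upper limit.
  The second one is where local compactness enters: bounded selections have cluster points.\<close>

lemma near_if_in_upper_limit:
  fixes A :: "nat \<Rightarrow> 'a::metric_space set"
  assumes "\<And>k p. N \<le> k \<Longrightarrow> p \<in> A k \<Longrightarrow> \<exists>q\<in>B. dist p q < e"
    and "p \<in> upper_limit A" "0 < e"
  shows "\<exists>q\<in>B. dist p q < 2 * e"
proof -
  obtain k z where "N \<le> k" "z \<in> A k" "dist z p < e"
    using assms(2,3) unfolding upper_limit_approachable by blast
  moreover from this obtain q where "q \<in> B" "dist z q < e"
    using assms(1) by blast
  ultimately show ?thesis
    using dist_triangle[of p q z] by (force simp: dist_commute)
qed

lemma near_upper_limit:
  fixes A :: "nat \<Rightarrow> 'a::heine_borel set"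
  assumes near: "\<And>k. N \<le> k \<Longrightarrow> \<exists>q\<in>A k. dist p q < e"
  shows "\<exists>q\<in>upper_limit A. dist p q \<le> e"
proof -
  have "\<forall>k. \<exists>q. q \<in> A (N + k) \<and> dist p q < e"
    using near by (meson le_add1)
  then have "\<exists>q. \<forall>k. q k \<in> A (N + k) \<and> dist p (q k) < e"
    by (rule choice)
  then obtain q where q: "\<And>k. q k \<in> A (N + k)" "\<And>k. dist p (q k) < e"
    by blast
  have "bounded (range q)"
    using less_imp_le[OF q(2)] by (intro bounded_subset[OF bounded_cball[of p e]]) auto
  then obtain z f where f: "strict_mono f" "(q \<circ> f) \<longlonglongrightarrow> z"
    using bounded_imp_convergent_subsequence by blast
  have "z \<in> cball p e"
    using f(2) by (rule closed_sequentially[OF closed_cball, rotated])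
      (use less_imp_le[OF q(2)] in auto)
  moreover have "z \<in> upper_limit A"
    unfolding upper_limit_approachable
  proof (intro allI impI)
    fix n and d :: real
    assume "0 < d"
    then have "\<forall>\<^sub>F k in sequentially. dist ((q \<circ> f) k) z < d"
      using f(2) by (rule tendstoD[rotated])
    then have "\<forall>\<^sub>F k in sequentially. dist ((q \<circ> f) k) z < d \<and> n \<le> k"
      using eventually_ge_at_top by (rule eventually_conj)
    then obtain k where k: "dist (q (f k)) z < d" "n \<le> k"
      by (auto dest!: eventually_happens)
    moreover have "n \<le> N + f k"
      using k(2) seq_suble[OF f(1), of k] by linarith
    ultimately show "\<exists>j\<ge>n. \<exists>y\<in>A j. dist y z < d"
      using q(1) by blast
  qed
  ultimately show ?thesis
    by auto
qed

lemma upper_limit_endographs: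
  fixes \<sigma> :: "nat \<Rightarrow> real ^ 'm \<Rightarrow> real"
  assumes fuzzy: "\<And>n. fuzzy_set (\<sigma> n)"
  obtains u where "fuzzy_set u" "upper_semicontinuous u"
    "endograph u = upper_limit (\<lambda>n. endograph (\<sigma> n))"
proof (rule endograph_of_closed)
  let ?E = "upper_limit (\<lambda>n. endograph (\<sigma> n))"
  show "closed ?E"
    unfolding upper_limit_def by auto
  show "t \<in> {0..1}" if "(x, t) \<in> ?E" for x t
  proof -
    have "?E \<subseteq> closure (\<Union>k\<in>{0..}. endograph (\<sigma> k))"
      unfolding upper_limit_def by blast
    also have "\<dots> \<subseteq> UNIV \<times> {0..1}"
      by (intro closure_minimal closed_Times closed_UNIV closed_real_atLeastAtMost)
        (auto simp: endograph_def)
    finally show ?thesis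
      using that by auto
  qed
  show "(x, 0) \<in> ?E" for x
  proof -
    have "(x, 0) \<in> endograph (\<sigma> n)" for n
      using fuzzy[of n] by (auto simp: endograph_def fuzzy_set_def)
    then show ?thesis
      unfolding upper_limit_approachable by (metis dist_self order_refl)
  qed
  show "(x, s) \<in> ?E" if "(x, t) \<in> ?E" "0 \<le> s" "s \<le> t" for x s t
    unfolding upper_limit_approachable
  proof (intro allI impI)
    fix n and e :: real
    assume "0 < e"
    then obtain k y r where k: "n \<le> k" "(y, r) \<in> endograph (\<sigma> k)" "dist (y, r) (x, t) < e"
      using \<open>(x, t) \<in> ?E\<close> unfolding upper_limit_approachable by fast
    \<comment> \<open>Truncating the approximating point at height \<open>s\<close> moves it no further from \<open>(x, s)\<close> than it
      was from \<open>(x, t)\<close>, since \<open>s \<le> t\<close>.\<close>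
    have "(y, min s r) \<in> endograph (\<sigma> k)"
      using k(2) that(2) by (auto simp: endograph_def)
    moreover have "dist (min s r) s \<le> dist r t"
      using that(3) by (auto simp: dist_real_def)
    then have "dist (y, min s r) (x, s) \<le> dist (y, r) (x, t)"
      by (auto simp: dist_Pair_Pair intro!: real_sqrt_le_mono add_left_mono power_mono)
    ultimately show "\<exists>k\<ge>n. \<exists>q\<in>endograph (\<sigma> k). dist q (x, s) < e"
      using k by (meson order.strict_trans1)
  qed
qed (rule that)

text \<open>An approximant at distance less than \<open>\<alpha>/2\<close> has, near each point of the \<open>\<alpha>\<close>-cut, a point of
  height at least \<open>\<alpha>/2\<close>; so one bounded cut of one approximant confines the whole cut.\<close>

lemma bounded_cut_if_approximable:
  assumes "fuzzy_set u"
    and approx: "\<And>e. 0 < e \<Longrightarrow> \<exists>v\<in>F_USCG. H_end v u < e"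
    and "\<alpha> \<in> {0<..1}"
  shows "bounded (cut u \<alpha>)"
proof -
  have \<alpha>: "0 < \<alpha>" "\<alpha> \<le> 1"
    using assms(3) by auto
  then obtain v where v: "v \<in> F_USCG" "H_end v u < \<alpha> / 2"
    using approx[of "\<alpha> / 2"] by auto
  have "fuzzy_set v"
    using v(1) by (simp add: F_USCG_def)
  have near: "\<exists>y\<in>cut v (\<alpha> / 2). dist x y \<le> \<alpha> / 2" if "x \<in> cut u \<alpha>" for x
  proof -
    have "(x, \<alpha>) \<in> endograph u"
      using that \<alpha> by (auto simp: cut_def endograph_def)
    then obtain y t where yt: "(y, t) \<in> endograph v" "dist (x, \<alpha>) (y, t) < \<alpha> / 2"
      using H_end_lessD[OF assms(1) \<open>fuzzy_set v\<close>] v(2) H_end_commute by (metis surj_pair)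
    have "dist x y < \<alpha> / 2" "dist \<alpha> t < \<alpha> / 2"
      using yt(2) dist_fst_le[of "(x, \<alpha>)" "(y, t)"] dist_snd_le[of "(x, \<alpha>)" "(y, t)"] by auto
    have "\<alpha> / 2 \<le> t"
      using \<open>dist \<alpha> t < \<alpha> / 2\<close> by (simp add: dist_real_def abs_if split: if_splits)
    then have "y \<in> cut v (\<alpha> / 2)"
      using yt(1) \<alpha> by (simp add: cut_def endograph_def)
    then show ?thesis
      using \<open>dist x y < \<alpha> / 2\<close> by (intro bexI[of _ y]) auto
  qed
  have "bounded (cut v (\<alpha> / 2))"
    using v(1) \<alpha> by (auto simp: F_USCG_def)
  then obtain c r where r: "\<And>y. y \<in> cut v (\<alpha> / 2) \<Longrightarrow> dist c y \<le> r"
    unfolding bounded_def by blast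
  have "dist c x \<le> r + \<alpha> / 2" if "x \<in> cut u \<alpha>" for x
  proof -
    obtain y where "y \<in> cut v (\<alpha> / 2)" "dist x y \<le> \<alpha> / 2"
      using near \<open>x \<in> cut u \<alpha>\<close> by blast
    then show ?thesis
      using r[of y] dist_triangle[of c x y] by (simp add: dist_commute)
  qed
  then show ?thesis
    unfolding bounded_def by blast
qed

lemma mcomplete_F_USCG: "Metric_space.mcomplete (F_USCG :: (real ^ 'm \<Rightarrow> real) set) H_end"
proof -
  interpret Metric_space "F_USCG :: (real ^ 'm \<Rightarrow> real) set" H_end
    by (rule Metric_space_F_USCG)
  show ?thesis
    unfolding mcomplete_def
  proof (intro allI impI)
    fix \<sigma> :: "nat \<Rightarrow> real ^ 'm \<Rightarrow> real"
    assume "MCauchy \<sigma>"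
    then have mem: "\<sigma> n \<in> F_USCG" for n
      by (auto simp: MCauchy_def)
    then have fuzzy: "fuzzy_set (\<sigma> n)" for n
      by (simp add: F_USCG_def)
    obtain u where u: "fuzzy_set u" "upper_semicontinuous u"
      "endograph u = upper_limit (\<lambda>n. endograph (\<sigma> n))"
      using upper_limit_endographs[of \<sigma>] fuzzy by blast
    have conv: "\<exists>N. \<forall>n\<ge>N. H_end (\<sigma> n) u < e" if "0 < e" for e
    proof -
      define d where "d = e / 3"
      have "0 < d"
        using that by (simp add: d_def)
      then obtain N where N: "\<And>m n. N \<le> m \<Longrightarrow> N \<le> n \<Longrightarrow> H_end (\<sigma> m) (\<sigma> n) < d"
        using \<open>MCauchy \<sigma>\<close> unfolding MCauchy_def by meson
      have near: "\<exists>q\<in>endograph (\<sigma> n). dist p q < d"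
        if "N \<le> m" "N \<le> n" "p \<in> endograph (\<sigma> m)" for m n p
        using H_end_lessD fuzzy N that by blast
      have "H_end (\<sigma> n) u \<le> 2 * d" if "N \<le> n" for n
      proof (rule H_end_leI)
        show "0 \<le> 2 * d"
          using \<open>0 < d\<close> by simp
      next
        fix p assume p: "p \<in> endograph (\<sigma> n)"
        have "\<exists>q\<in>upper_limit (\<lambda>n. endograph (\<sigma> n)). dist p q \<le> d"
          by (rule near_upper_limit) (use near p that in blast)
        then show "\<exists>q\<in>endograph u. dist p q \<le> 2 * d"
          using u(3) \<open>0 < d\<close> by force
      next
        fix q assume "q \<in> endograph u"
        then have "q \<in> upper_limit (\<lambda>n. endograph (\<sigma> n))"
          by (simp add: u(3))
        with near[OF _ that] have "\<exists>p\<in>endograph (\<sigma> n). dist q p < 2 * d"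
          using \<open>0 < d\<close> by (rule near_if_in_upper_limit)
        then show "\<exists>p\<in>endograph (\<sigma> n). dist p q \<le> 2 * d"
          by (auto simp: dist_commute intro: less_imp_le)
      qed
      then show ?thesis
        using \<open>0 < d\<close> by (intro exI[of _ N]) (force simp: d_def)
    qed
    have "bounded (cut u \<alpha>)" if "\<alpha> \<in> {0<..1}" for \<alpha>
      using u(1) _ that by (rule bounded_cut_if_approximable) (use conv mem in blast)
    then have "u \<in> F_USCG"
      using u by (simp add: F_USCG_def)
    then have "limitin mtopology \<sigma> u sequentially"
      using conv mem by (auto simp: limitin_metric eventually_sequentially)
    then show "\<exists>u. limitin mtopology \<sigma> u sequentially"
      by blast
  qed
qed

section \<open>Density\<close>

lemma F_USCB_subset_F_USCG: "(F_USCB :: (real ^ 'm \<Rightarrow> real) set) \<subseteq> F_USCG"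
proof -
  have "bounded (cut u \<alpha>)"
    if "bounded (cut u 0)" "\<alpha> \<in> {0<..1}" for u :: "real ^ 'm \<Rightarrow> real" and \<alpha>
  proof (rule bounded_subset[OF that(1)])
    have "cut u \<alpha> \<subseteq> {x. 0 < u x}"
      using that(2) by (auto simp: cut_def)
    also have "\<dots> \<subseteq> cut u 0"
      by (simp add: cut_def closure_subset)
    finally show "cut u \<alpha> \<subseteq> cut u 0" .
  qed
  then show ?thesis
    by (auto simp: F_USCB_def F_USCG_def)
qed

text \<open>The approximant keeps the values that are at least \<open>e\<close> and replaces the others by 0. Keeping
  the value \<open>e\<close> itself preserves upper semicontinuity, since \<open>{x. u x < e}\<close> is open; and \<open>e \<le> 1\<close>
  makes \<open>e\<close> a level at which the cut is known to be bounded.\<close>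

lemma F_USCB_approximates:
  assumes u: "u \<in> F_USCG" and e: "0 < e" "e \<le> 1"
  obtains v where "v \<in> F_USCB" "H_end u v \<le> e"
proof
  define v where "v x = (if e \<le> u x then u x else 0)" for x
  have fuzzy: "fuzzy_set u" and usc: "upper_semicontinuous u" and bdd: "bounded (cut u e)"
    using u e by (auto simp: F_USCG_def)
  have v_le: "v x \<le> u x" for x
    using fuzzy by (simp add: v_def fuzzy_set_def)
  have "fuzzy_set v"
    using fuzzy by (simp add: v_def fuzzy_set_def)
  moreover have "upper_semicontinuous v"
    unfolding upper_semicontinuous_def
  proof (intro allI impI)
    fix x and d :: real
    assume "0 < d"
    show "\<forall>\<^sub>F y in nhds x. v y < v x + d"
    proof (cases "e \<le> u x")
      case True
      have "\<forall>\<^sub>F y in nhds x. u y < u x + d"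
        using usc \<open>0 < d\<close> by (simp add: upper_semicontinuous_def)
      then show ?thesis
        by (rule eventually_mono)
          (use True v_le in \<open>auto simp: v_def[of x] intro: le_less_trans\<close>)
    next
      case False
      have "\<forall>\<^sub>F y in nhds x. u y < u x + (e - u x)"
        using usc False unfolding upper_semicontinuous_def by (meson diff_gt_0_iff_gt not_le)
      then show ?thesis
        by (rule eventually_mono) (use False \<open>0 < d\<close> in \<open>auto simp: v_def\<close>)
    qed
  qed
  moreover have "bounded (cut v 0)"
  proof -
    have "{x. 0 < v x} \<subseteq> cut u e"
      using e by (auto simp: v_def cut_def split: if_splits)
    then show ?thesis
      using bdd bounded_subset by (auto simp: cut_def)
  qed
  ultimately show "v \<in> F_USCB"
    by (simp add: F_USCB_def)
  show "H_end u v \<le> e"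
  proof (rule H_end_leI)
    show "0 \<le> e"
      using e by simp
  next
    fix p assume "p \<in> endograph u"
    then obtain x t where p: "p = (x, t)" "0 \<le> t" "t \<le> 1" "t \<le> u x"
      by (auto simp: endograph_def)
    show "\<exists>q\<in>endograph v. dist p q \<le> e"
    proof (cases "e \<le> u x")
      case True
      then have "p \<in> endograph v"
        using p by (simp add: endograph_def v_def)
      then show ?thesis
        using e by (intro bexI[of _ p]) auto
    next
      case False
      then show ?thesis
        using p by (intro bexI[of _ "(x, 0)"])
          (auto simp: endograph_def v_def dist_Pair_Pair dist_real_def)
    qed
  next
    fix q assume "q \<in> endograph v"
    then have "q \<in> endograph u"
      using endograph_mono_iff[OF \<open>fuzzy_set v\<close>] v_le by blast
    then show "\<exists>p\<in>endograph u. dist p q \<le> e"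
      using e by (intro bexI[of _ q]) auto
  qed
qed

theorem theorem8p2:
  shows "Metric_space (F_USCG :: (real ^ 'm \<Rightarrow> real) set) H_end
    \<and> Metric_space.mcomplete (F_USCG :: (real ^ 'm \<Rightarrow> real) set) H_end
    \<and> (F_USCB :: (real ^ 'm \<Rightarrow> real) set) \<subseteq> F_USCG
    \<and> Metric_space.mtopology (F_USCG :: (real ^ 'm \<Rightarrow> real) set) H_end closure_of F_USCB = F_USCG"
proof -
  interpret Metric_space "F_USCG :: (real ^ 'm \<Rightarrow> real) set" H_end
    by (rule Metric_space_F_USCG)
  have "\<exists>v\<in>F_USCB. v \<in> mball u r" if "u \<in> F_USCG" "0 < r" for u :: "real ^ 'm \<Rightarrow> real" and r
  proof -
    obtain v where v: "v \<in> F_USCB" "H_end u v \<le> min 1 (r / 2)"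
      using F_USCB_approximates[OF \<open>u \<in> F_USCG\<close>, of "min 1 (r / 2)"] \<open>0 < r\<close> by auto
    then have "v \<in> mball u r"
      using that F_USCB_subset_F_USCG by auto
    then show ?thesis
      using v(1) by blast
  qed
  then have "mtopology closure_of F_USCB = F_USCG"
    by (auto simp: metric_closure_of)
  then show ?thesis
    using Metric_space_F_USCG mcomplete_F_USCG F_USCB_subset_F_USCG by blast
qed

end
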